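(* Let $x_0\in\operatorname{dom}\psi$ be the starting point of Algorithm 1 (described in the context), with iterates $x_k,y_k,z_k$, and run Algorithm 2 (described in the context) with $\tilde z_0=x_0$ and with the same random sets $S_k$, producing $u_k,\tilde z_k$. Define $$\tilde x_k=\begin{cases}\tilde z_0,&k=0,\\ \theta_{k-1}^2u_k+\tilde z_k,&k\ge1,\end{cases}\qquad\text{and}\qquad\tilde y_k=\theta_k^2u_k+\tilde z_k,\quad k\ge0.$$ Then $x_k=\tilde x_k$, $y_k=\tilde y_k$ and $z_k=\tilde z_k$ for all $k\ge0$. That is, Algorithms 1 and 2 are equivalent.
   Context: Blocks: $N=N_1+\dots+N_n$, $[n]=\{1,\dots,n\}$; for $x\in\mathbf{R}^N$, $x^{(i)}\in\mathbf{R}^{N_i}$ is the $i$-th block of $x$, and $\nabla_if(x)\in\mathbf{R}^{N_i}$ is the $i$-th block of $\nabla f(x)$. For each $i$ a symmetric positive definite matrix $B_i\in\mathbf{R}^{N_i\times N_i}$ is fixed and $\|t\|_{(i)}=\langle B_it,t\rangle^{1/2}$. $f:\mathbf{R}^N\to\mathbf{R}$ is convex and differentiable; $\psi(x)=\sum_{i=1}^n\psi_i(x^{(i)})$ with each $\psi_i:\mathbf{R}^{N_i}\to\mathbf{R}\cup\{+\infty\}$ convex; $v_1,\dots,v_n>0$. $\hat S$ is a uniform block sampling (a random subset of $[n]$ with $\mathbf{P}(i\in\hat S)$ the same for all $i$) and $\tau=\mathbf{E}[|\hat S|]>0$. In both algorithms $\theta_0=\tau/n$ and $\theta_{k+1}=\frac{\sqrt{\theta_k^4+4\theta_k^2}-\theta_k^2}{2}$,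 and $S_k$ is a random set of blocks distributed as $\hat S$. The minimizers below are assumed to exist, so that the algorithms are well defined. Algorithm 1: given $x_0$, set $z_0=x_0$. For $k\ge0$: (1) $y_k=(1-\theta_k)x_k+\theta_kz_k$; (2) generate $S_k$; (3) $z_{k+1}^{(i)}=z_k^{(i)}$ for $i\notin S_k$, and for $i\in S_k$ $$z_{k+1}^{(i)}=\arg\min_{z\in\mathbf{R}^{N_i}}\left\{\langle\nabla_if(y_k),z-y_k^{(i)}\rangle+\frac{n\theta_kv_i}{2\tau}\|z-z_k^{(i)}\|_{(i)}^2+\psi_i(z)\right\};$$ (4) $x_{k+1}=y_k+\frac n\tau\theta_k(z_{k+1}-z_k)$. Algorithm 2: given $\tilde z_0$, set $u_0=0$. For $k\ge0$: (1) generate $S_k$; (2) for $i\notin S_k$, $u_{k+1}^{(i)}=u_k^{(i)}$ and $\tilde z_{k+1}^{(i)}=\tilde z_k^{(i)}$; (3) for $i\in S_k$, $$t_k^{(i)}=\arg\min_{t\in\mathbf{R}^{N_i}}\left\{\langle\nabla_if(\theta_k^2u_k+\tilde z_k),t\rangle+\frac{n\theta_kv_i}{2\tau}\|t\|_{(i)}^2+\psi_i(\tilde z_k^{(i)}+t)\right\},$$ $$\tilde z_{k+1}^{(i)}=\tilde z_k^{(i)}+t_k^{(i)},\qquad u_{k+1}^{(i)}=u_k^{(i)}-\frac{1-\frac n\tau\theta_k}{\theta_k^2}\,t_k^{(i)}.$$ *)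

theory Defs
  imports "HOL-Probability.Probability"
begin

text \<open>
  A map \<open>b\<close> from coordinates to block indices partitions the coordinates of \<open>real ^ 'd\<close>
  (dimension \<open>N = CARD('d)\<close>) into \<open>n = CARD('n)\<close> blocks, block \<open>i\<close> having \<open>N\<^sub>i = card {j. b j = i}\<close>
  coordinates.  The space of block-\<open>i\<close> vectors depends on the value \<open>i\<close> and so cannot be a type; it
  is represented by the coordinate subspace \<open>block_space b i\<close> of \<open>real ^ 'd\<close>.  Objects living on
  that space (the functions \<open>\<psi>\<^sub>i\<close>, the matrices \<open>B\<^sub>i\<close>) are constrained and used only there:
  the values of \<open>\<psi>\<^sub>i\<close> outside \<open>block_space b i\<close>, and the entries of \<open>B\<^sub>i\<close> outside
  the rows and columns of block \<open>i\<close>, are irrelevant.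
\<close>

definition block_space :: "('d::finite \<Rightarrow> 'n) \<Rightarrow> 'n \<Rightarrow> (real ^ 'd) set" where
  "block_space b i = {t. \<forall>j. b j \<noteq> i \<longrightarrow> t $ j = 0}"

definition block :: "('d::finite \<Rightarrow> 'n) \<Rightarrow> 'n \<Rightarrow> real ^ 'd \<Rightarrow> real ^ 'd" where
  "block b i x = (\<chi> j. if b j = i then x $ j else 0)"

definition sym_pos_def_on_block :: "('d::finite \<Rightarrow> 'n) \<Rightarrow> 'n \<Rightarrow> real ^ 'd ^ 'd \<Rightarrow> bool" where
  "sym_pos_def_on_block b i A \<longleftrightarrow>
     (\<forall>j k. b j = i \<longrightarrow> b k = i \<longrightarrow> A $ j $ k = A $ k $ j) \<and>
     (\<forall>t\<in>block_space b i. t \<noteq> 0 \<longrightarrow> (A *v t) \<bullet> t > 0)"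

text \<open>
  Used only for \<open>t\<close> in the block space of \<open>A\<close>, where just the entries of \<open>A\<close> in
  that block contribute.
\<close>

definition mat_norm :: "real ^ 'd ^ 'd \<Rightarrow> real ^ 'd::finite \<Rightarrow> real" where
  "mat_norm A t = sqrt ((A *v t) \<bullet> t)"

definition gradient :: "(real ^ 'd::finite \<Rightarrow> real) \<Rightarrow> real ^ 'd \<Rightarrow> real ^ 'd" where
  "gradient f x = (THE g. GDERIV f x :> g)"

text \<open>
  Convexity of a function with values in \<open>\<real> \<union> {+\<infinity>}\<close>.  Since \<open>-\<infinity>\<close> is excluded and
  \<open>0 * \<infinity> = 0\<close> for extended reals, the inequality is also correct (and trivial) for
  \<open>s = 0\<close> and \<open>s = 1\<close>.
\<close>

definition convex_extended_on :: "'a::real_vector set \<Rightarrow> ('a \<Rightarrow> ereal) \<Rightarrow> bool" where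
  "convex_extended_on C g \<longleftrightarrow>
     convex C \<and> (\<forall>x\<in>C. g x \<noteq> -\<infinity>) \<and>
     (\<forall>x\<in>C. \<forall>y\<in>C. \<forall>s\<in>{0..1}.
        g ((1 - s) *\<^sub>R x + s *\<^sub>R y) \<le> ereal (1 - s) * g x + ereal s * g y)"

definition separable_sum ::
    "('d::finite \<Rightarrow> 'n::finite) \<Rightarrow> ('n \<Rightarrow> real ^ 'd \<Rightarrow> ereal) \<Rightarrow> real ^ 'd \<Rightarrow> ereal" where
  "separable_sum b \<psi> x = (\<Sum>i\<in>UNIV. \<psi> i (block b i x))"

definition eff_domain :: "('a \<Rightarrow> ereal) \<Rightarrow> 'a set" where
  "eff_domain g = {x. g x < \<infinity>}"

text \<open>A sampling is given by its law, a probability mass function on the subsets of \<open>'n\<close>.\<close>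

definition uniform_sampling :: "'n::finite set pmf \<Rightarrow> bool" where
  "uniform_sampling P \<longleftrightarrow>
     (\<exists>p. \<forall>i. measure_pmf.prob P {S. i \<in> S} = p)"

definition mean_sampling_size :: "'n::finite set pmf \<Rightarrow> real" where
  "mean_sampling_size P = measure_pmf.expectation P (\<lambda>S. real (card S))"

primrec theta_seq :: "real \<Rightarrow> nat \<Rightarrow> real" where
  "theta_seq \<theta>0 0 = \<theta>0"
| "theta_seq \<theta>0 (Suc k) =
     (sqrt (theta_seq \<theta>0 k ^ 4 + 4 * theta_seq \<theta>0 k ^ 2) - theta_seq \<theta>0 k ^ 2) / 2"

text \<open>
  The two predicates below describe one realisation of the respective algorithm along a sequence
  \<open>S\<close> of sets of blocks.  The block subproblems are stated as membership in the set of minimizers,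
  so that the existence of the minimizers is part of the predicate and their uniqueness is not
  presupposed.
\<close>

definition algorithm1 ::
    "('d::finite \<Rightarrow> 'n::finite) \<Rightarrow> ('n \<Rightarrow> real ^ 'd ^ 'd) \<Rightarrow> ('n \<Rightarrow> real) \<Rightarrow>
     (real ^ 'd \<Rightarrow> real) \<Rightarrow> ('n \<Rightarrow> real ^ 'd \<Rightarrow> ereal) \<Rightarrow> real \<Rightarrow> (nat \<Rightarrow> real) \<Rightarrow> real ^ 'd \<Rightarrow>
     (nat \<Rightarrow> 'n set) \<Rightarrow>
     (nat \<Rightarrow> real ^ 'd) \<Rightarrow> (nat \<Rightarrow> real ^ 'd) \<Rightarrow> (nat \<Rightarrow> real ^ 'd) \<Rightarrow> bool" where
  "algorithm1 b B v f \<psi> \<tau> \<theta> x0 S x y z \<longleftrightarrow>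
     x 0 = x0 \<and> z 0 = x0 \<and>
     (\<forall>k. y k = (1 - \<theta> k) *\<^sub>R x k + \<theta> k *\<^sub>R z k \<and>
          (\<forall>i. i \<notin> S k \<longrightarrow> block b i (z (Suc k)) = block b i (z k)) \<and>
          (\<forall>i\<in>S k. is_arg_min
             (\<lambda>w. ereal (block b i (gradient f (y k)) \<bullet> (w - block b i (y k))
                     + real CARD('n) * \<theta> k * v i / (2 * \<tau>)
                         * (mat_norm (B i) (w - block b i (z k)))\<^sup>2)
                   + \<psi> i w)
             (\<lambda>w. w \<in> block_space b i)
             (block b i (z (Suc k)))) \<and>
          x (Suc k) = y k + (real CARD('n) / \<tau> * \<theta> k) *\<^sub>R (z (Suc k) - z k))"

definition algorithm2 ::
    "('d::finite \<Rightarrow> 'n::finite) \<Rightarrow> ('n \<Rightarrow> real ^ 'd ^ 'd) \<Rightarrow> ('n \<Rightarrow> real) \<Rightarrow>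
     (real ^ 'd \<Rightarrow> real) \<Rightarrow> ('n \<Rightarrow> real ^ 'd \<Rightarrow> ereal) \<Rightarrow> real \<Rightarrow> (nat \<Rightarrow> real) \<Rightarrow> real ^ 'd \<Rightarrow>
     (nat \<Rightarrow> 'n set) \<Rightarrow> (nat \<Rightarrow> real ^ 'd) \<Rightarrow> (nat \<Rightarrow> real ^ 'd) \<Rightarrow> bool" where
  "algorithm2 b B v f \<psi> \<tau> \<theta> z0 S u z \<longleftrightarrow>
     z 0 = z0 \<and> u 0 = 0 \<and>
     (\<forall>k. (\<forall>i. i \<notin> S k \<longrightarrow>
             block b i (u (Suc k)) = block b i (u k) \<and> block b i (z (Suc k)) = block b i (z k)) \<and>
          (\<forall>i\<in>S k. \<exists>t. is_arg_min
             (\<lambda>t. ereal (block b i (gradient f ((\<theta> k)\<^sup>2 *\<^sub>R u k + z k)) \<bullet> t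
                     + real CARD('n) * \<theta> k * v i / (2 * \<tau>) * (mat_norm (B i) t)\<^sup>2)
                   + \<psi> i (block b i (z k) + t))
             (\<lambda>t. t \<in> block_space b i) t \<and>
             block b i (z (Suc k)) = block b i (z k) + t \<and>
             block b i (u (Suc k)) =
               block b i (u k) - ((1 - real CARD('n) / \<tau> * \<theta> k) / (\<theta> k)\<^sup>2) *\<^sub>R t))"

end

theory Submission
  imports Defs
begin

text \<open>
  With \<open>x\<^sub>k = \<theta>\<^sub>k\<^sub>-\<^sub>1\<^sup>2 u\<^sub>k + z\<^sub>k\<close>, the relation
  \<open>\<theta>\<^sub>k\<^sup>2 = (1 - \<theta>\<^sub>k) \<theta>\<^sub>k\<^sub>-\<^sub>1\<^sup>2\<close> turns the convex combination defining \<open>y\<^sub>k\<close> into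
  \<open>\<theta>\<^sub>k\<^sup>2 u\<^sub>k + z\<^sub>k\<close>.  Both algorithms then use the same gradient, and under \<open>w = z\<^sub>k + t\<close>
  their block objectives differ by a constant.  The objectives are strictly convex and, as \<open>x\<^sub>0\<close>
  lies in the domain of \<open>\<psi>\<close>, not identically \<open>\<infinity>\<close>, so their minimizers coincide.
\<close>

section \<open>Step-size sequence\<close>

lemma theta_seq_pos:
  assumes "0 < a"
  shows "0 < theta_seq a k"
proof (induction k)
  case 0
  then show ?case using assms by simp
next
  case (Suc k)
  let ?t = "theta_seq a k"
  have "(?t\<^sup>2)\<^sup>2 < ?t ^ 4 + 4 * ?t\<^sup>2"
    using Suc by simp
  then have "?t\<^sup>2 < sqrt (?t ^ 4 + 4 * ?t\<^sup>2)"
    by (rule real_less_rsqrt)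
  then show ?case by simp
qed

text \<open>By the quadratic formula, \<open>theta_seq a (Suc k)\<close> is a root of
  \<open>X^2 + t^2 * X - t^2\<close>, where \<open>t = theta_seq a k\<close>.\<close>

lemma theta_seq_Suc_square:
  "(theta_seq a (Suc k))\<^sup>2 = (1 - theta_seq a (Suc k)) * (theta_seq a k)\<^sup>2"
proof -
  let ?t = "theta_seq a k"
  define s where "s = sqrt (?t ^ 4 + 4 * ?t\<^sup>2)"
  have s: "s\<^sup>2 = ?t ^ 4 + 4 * ?t\<^sup>2"
    unfolding s_def by simp
  have eq: "theta_seq a (Suc k) = (s - ?t\<^sup>2) / 2"
    by (simp add: s_def)
  show ?thesis
    unfolding eq using s by (simp add: field_simps power2_eq_square power4_eq_xxxx)
qed

section \<open>Blocks and their norms\<close>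

lemma block_in_block_space: "block b i x \<in> block_space b i"
  by (simp add: block_def block_space_def)

lemma block_diff: "block b i (x - y) = block b i x - block b i y"
  by (simp add: block_def vec_eq_iff)

lemma block_scaleR: "block b i (c *\<^sub>R x) = c *\<^sub>R block b i x"
  by (simp add: block_def vec_eq_iff)

lemma subspace_block_space: "subspace (block_space b i)"
  by (simp add: subspace_def block_space_def)

lemma vec_eq_blockI:
  assumes "\<And>i. block b i x = block b i y"
  shows "x = y"
proof (rule vec_eq_iff[THEN iffD2], rule allI)
  fix j
  show "x $ j = y $ j"
    using arg_cong[OF assms[of "b j"], of "\<lambda>t. t $ j"] by (simp add: block_def)
qed

text \<open>The real \<open>sqrt\<close> is odd, so squaring it returns the argument only where that
  is nonnegative; positive definiteness ensures this on the block space.\<close>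

lemma mat_norm_square:
  assumes "sym_pos_def_on_block b i A" and "t \<in> block_space b i"
  shows "(mat_norm A t)\<^sup>2 = (A *v t) \<bullet> t"
proof -
  have "0 \<le> (A *v t) \<bullet> t"
    using assms by (cases "t = 0") (auto simp: sym_pos_def_on_block_def less_imp_le)
  then show ?thesis
    by (simp add: mat_norm_def)
qed

lemma mat_norm_midpoint_less:
  assumes A: "sym_pos_def_on_block b i A"
    and s: "s \<in> block_space b i" and t: "t \<in> block_space b i" and "s \<noteq> t"
  shows "(mat_norm A ((1/2) *\<^sub>R s + (1/2) *\<^sub>R t))\<^sup>2 < ((mat_norm A s)\<^sup>2 + (mat_norm A t)\<^sup>2) / 2"
proof -
  note sub = subspace_block_space[of b i]
  define m where "m = (1/2) *\<^sub>R s + (1/2) *\<^sub>R t"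
  have mid: "m \<in> block_space b i"
    unfolding m_def using sub s t by (intro subspace_add subspace_scale)
  have "s - t \<in> block_space b i" "s - t \<noteq> 0"
    using sub s t \<open>s \<noteq> t\<close> by (auto intro: subspace_diff)
  then have "0 < (A *v (s - t)) \<bullet> (s - t)"
    using A by (auto simp: sym_pos_def_on_block_def)
  \<comment> \<open>Parallelogram identity: the convexity gap at the midpoint is a quarter of the
    form at \<open>s - t\<close>.\<close>
  moreover have "4 * ((A *v m) \<bullet> m)
      = 2 * ((A *v s) \<bullet> s) + 2 * ((A *v t) \<bullet> t) - (A *v (s - t)) \<bullet> (s - t)"
    by (simp add: m_def matrix_vector_right_distrib matrix_vector_mult_diff_distrib
        matrix_vector_mult_scaleR inner_simps algebra_simps)
  ultimately show ?thesis
    unfolding m_def[symmetric] mat_norm_square[OF A mid] mat_norm_square[OF A s]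
      mat_norm_square[OF A t] by argo
qed

section \<open>Uniqueness of block minimizers\<close>

text \<open>The midpoint of two distinct minimizers would have a smaller value. The point
  \<open>p\<close> keeps the minimum below \<infinity>; an objective that is \<infinity> on all of
  \<open>C\<close> is minimized everywhere.\<close>

lemma is_arg_min_unique_midpoint:
  fixes q :: "'a::real_vector \<Rightarrow> real" and g :: "'a \<Rightarrow> ereal"
  assumes g: "convex_extended_on C g"
    and q: "\<And>x y. x \<in> C \<Longrightarrow> y \<in> C \<Longrightarrow> x \<noteq> y \<Longrightarrow>
              q ((1/2) *\<^sub>R x + (1/2) *\<^sub>R y) < (q x + q y) / 2"
    and p: "p \<in> C" "g p < \<infinity>"
    and x: "is_arg_min (\<lambda>w. ereal (q w) + g w) (\<lambda>w. w \<in> C) x"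
    and y: "is_arg_min (\<lambda>w. ereal (q w) + g w) (\<lambda>w. w \<in> C) y"
  shows "x = y"
proof (rule ccontr)
  assume "x \<noteq> y"
  have xC: "x \<in> C" and yC: "y \<in> C"
    and xmin: "\<And>w. w \<in> C \<Longrightarrow> ereal (q x) + g x \<le> ereal (q w) + g w"
    and ymin: "\<And>w. w \<in> C \<Longrightarrow> ereal (q y) + g y \<le> ereal (q w) + g w"
    using x y by (auto simp: is_arg_min_linorder)
  have nm: "\<And>w. w \<in> C \<Longrightarrow> g w \<noteq> -\<infinity>"
    using g by (auto simp: convex_extended_on_def)
  \<comment> \<open>Comparison with \<open>p\<close> excludes \<infinity> and the convexity
    predicate excludes -\<infinity>, so the rest is real arithmetic.\<close>
  obtain r where r: "g x = ereal r"
    using xmin[OF p(1)] p(2) nm[OF xC] by (cases "g x") auto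
  obtain r' where r': "g y = ereal r'"
    using ymin[OF p(1)] p(2) nm[OF yC] by (cases "g y") auto
  let ?m = "(1/2) *\<^sub>R x + (1/2) *\<^sub>R y"
  have mC: "?m \<in> C"
    using g xC yC by (auto simp: convex_extended_on_def intro: convexD)
  have "g ((1 - 1/2) *\<^sub>R x + (1/2) *\<^sub>R y) \<le> ereal (1 - 1/2) * g x + ereal (1/2) * g y"
    using g xC yC unfolding convex_extended_on_def
    by (elim conjE ballE[where x = x] ballE[where x = y] ballE[where x = "1/2"]) auto
  then have gm: "g ?m \<le> ereal (r / 2 + r' / 2)"
    by (simp add: r r')
  have "ereal (q x + r) \<le> ereal (q ?m + (r / 2 + r' / 2))"
    using order_trans[OF xmin[OF mC] add_left_mono[OF gm, of "ereal (q ?m)"]] r by simp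
  moreover have "q x + r = q y + r'"
    using xmin[OF yC] ymin[OF xC] r r' by simp
  ultimately show False
    using q[OF xC yC \<open>x \<noteq> y\<close>] by simp
qed

text \<open>The substitution \<open>w = a + t\<close> is a bijection of the subspace
  \<open>C\<close>, and adding the real constant \<open>c\<close> preserves minimizers.\<close>

lemma is_arg_min_translate:
  fixes q :: "'a::real_vector \<Rightarrow> real" and g :: "'a \<Rightarrow> ereal"
  assumes C: "subspace C" and a: "a \<in> C"
    and t: "is_arg_min (\<lambda>t. ereal (q t) + g (a + t)) (\<lambda>t. t \<in> C) t"
  shows "is_arg_min (\<lambda>w. ereal (q (w - a) + c) + g w) (\<lambda>w. w \<in> C) (a + t)"
  unfolding is_arg_min_linorder
proof (intro conjI allI impI)
  show "a + t \<in> C"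
    using t C a by (auto simp: is_arg_min_linorder intro: subspace_add)
  fix w assume "w \<in> C"
  then have "w - a \<in> C"
    using C a by (auto intro: subspace_diff)
  then have "ereal (q t) + g (a + t) \<le> ereal (q (w - a)) + g (a + (w - a))"
    using t by (auto simp: is_arg_min_linorder)
  then have "ereal c + (ereal (q t) + g (a + t)) \<le> ereal c + (ereal (q (w - a)) + g w)"
    by (intro add_left_mono) simp
  then show "ereal (q (a + t - a) + c) + g (a + t) \<le> ereal (q (w - a) + c) + g w"
    by (simp flip: plus_ereal.simps add: ac_simps)
qed

text \<open>Compares the two block subproblems: \<open>a\<close> is the current block of
  \<open>z\<close>, \<open>e\<close> that of \<open>y\<close>. Replacing \<open>w - e\<close> by
  \<open>w - a\<close> in the linear term changes the objective by the constant
  \<open>l \<bullet> (a - e)\<close>.\<close>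

lemma prox_step_unique:
  fixes b :: "'d::finite \<Rightarrow> 'n::finite"
  assumes A: "sym_pos_def_on_block b i A" and c: "0 < c"
    and g: "convex_extended_on (block_space b i) g"
    and p: "p \<in> block_space b i" "g p < \<infinity>"
    and a: "a \<in> block_space b i"
    and w: "is_arg_min (\<lambda>w. ereal (l \<bullet> (w - e) + c * (mat_norm A (w - a))\<^sup>2) + g w)
              (\<lambda>w. w \<in> block_space b i) w"
    and t: "is_arg_min (\<lambda>t. ereal (l \<bullet> t + c * (mat_norm A t)\<^sup>2) + g (a + t))
              (\<lambda>t. t \<in> block_space b i) t"
  shows "w = a + t"
proof (rule is_arg_min_unique_midpoint[OF g _ p w])
  show "is_arg_min (\<lambda>w. ereal (l \<bullet> (w - e) + c * (mat_norm A (w - a))\<^sup>2) + g w)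
          (\<lambda>w. w \<in> block_space b i) (a + t)"
    using is_arg_min_translate[OF subspace_block_space a t, of "l \<bullet> (a - e)"]
    by (simp add: inner_diff_right algebra_simps)
  fix x y assume xy: "x \<in> block_space b i" "y \<in> block_space b i" "x \<noteq> y"
  let ?m = "(1/2) *\<^sub>R x + (1/2) *\<^sub>R y"
  have "?m - a = (1/2) *\<^sub>R (x - a) + (1/2) *\<^sub>R (y - a)"
    by (simp add: algebra_simps flip: scaleR_left.add)
  then have "(mat_norm A (?m - a))\<^sup>2 < ((mat_norm A (x - a))\<^sup>2 + (mat_norm A (y - a))\<^sup>2) / 2"
    using mat_norm_midpoint_less[OF A, of "x - a" "y - a"] xy a
    by (auto intro: subspace_diff[OF subspace_block_space])
  then have "c * (mat_norm A (?m - a))\<^sup>2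
      < c * (((mat_norm A (x - a))\<^sup>2 + (mat_norm A (y - a))\<^sup>2) / 2)"
    using c by simp
  \<comment> \<open>The linear term is affine, so strictness comes from the quadratic term
    alone.\<close>
  moreover have "l \<bullet> (?m - e) = (l \<bullet> (x - e) + l \<bullet> (y - e)) / 2"
    by (simp add: inner_simps field_simps)
  ultimately show "l \<bullet> (?m - e) + c * (mat_norm A (?m - a))\<^sup>2
      < (l \<bullet> (x - e) + c * (mat_norm A (x - a))\<^sup>2
          + (l \<bullet> (y - e) + c * (mat_norm A (y - a))\<^sup>2)) / 2"
    by (simp add: field_simps)
qed

section \<open>Equivalence of the algorithms\<close>

text \<open>A single infinite summand makes the sum infinite. Applied to \<open>x0\<close>, this
  supplies a point of finite value in every block subproblem.\<close>

lemma eff_domain_separable_sumD: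
  assumes "x \<in> eff_domain (separable_sum b \<psi>)"
  shows "\<psi> i (block b i x) < \<infinity>"
proof (rule ccontr)
  assume "\<not> ?thesis"
  then have "(\<Sum>i\<in>UNIV. \<psi> i (block b i x)) = \<infinity>"
    by (subst sum_Pinfty) auto
  then show False
    using assms by (simp add: eff_domain_def separable_sum_def)
qed

lemma algorithms_equivalent:
  fixes b :: "'d::finite \<Rightarrow> 'n::finite"
  assumes B: "\<And>i. sym_pos_def_on_block b i (B i)"
    and v: "\<And>i. 0 < v i"
    and \<psi>: "\<And>i. convex_extended_on (block_space b i) (\<psi> i)"
    and \<tau>: "0 < \<tau>"
    and \<theta>_pos: "\<And>k. 0 < \<theta> k"
    and \<theta>_rec: "\<And>k. (\<theta> (Suc k))\<^sup>2 = (1 - \<theta> (Suc k)) * (\<theta> k)\<^sup>2"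
    and x0: "x0 \<in> eff_domain (separable_sum b \<psi>)"
    and alg1: "algorithm1 b B v f \<psi> \<tau> \<theta> x0 S x y z"
    and alg2: "algorithm2 b B v f \<psi> \<tau> \<theta> x0 S u ztil"
  shows "x k = (if k = 0 then ztil 0 else (\<theta> (k - 1))\<^sup>2 *\<^sub>R u k + ztil k) \<and>
         y k = (\<theta> k)\<^sup>2 *\<^sub>R u k + ztil k \<and> z k = ztil k"
proof -
  let ?r = "real CARD('n) / \<tau>"
  have y_eq: "y k = (1 - \<theta> k) *\<^sub>R x k + \<theta> k *\<^sub>R z k"
    and x_Suc: "x (Suc k) = y k + (?r * \<theta> k) *\<^sub>R (z (Suc k) - z k)" for k
    using alg1 by (auto simp: algorithm1_def)
  have y_step: "y k = (\<theta> k)\<^sup>2 *\<^sub>R u k + ztil k"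
    if "x k = (if k = 0 then ztil 0 else (\<theta> (k - 1))\<^sup>2 *\<^sub>R u k + ztil k)" "z k = ztil k" for k
  proof (cases k)
    \<comment> \<open>Here \<open>x 0 = z 0\<close> and \<open>u 0 = 0\<close>, so the value of
      \<open>\<theta> 0\<close> does not affect \<open>y 0\<close>.\<close>
    case 0
    then show ?thesis
      using that y_eq[of k] alg2 by (simp add: algorithm2_def flip: scaleR_left.add)
  next
    case (Suc j)
    \<comment> \<open>The weights of \<open>ztil k\<close> sum to 1, and the recurrence turns the
      weight of \<open>u k\<close> into the square of \<open>\<theta> k\<close>.\<close>
    have "y k = ((1 - \<theta> k) * (\<theta> j)\<^sup>2) *\<^sub>R u k + ((1 - \<theta> k) + \<theta> k) *\<^sub>R ztil k"
      using that Suc unfolding y_eq[of k] scaleR_left.add by (simp add: scaleR_add_right)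
    then show ?thesis
      using \<theta>_rec[of j] Suc by simp
  qed
  have step: "x (Suc k) = (\<theta> k)\<^sup>2 *\<^sub>R u (Suc k) + ztil (Suc k) \<and> z (Suc k) = ztil (Suc k)"
    if yk: "y k = (\<theta> k)\<^sup>2 *\<^sub>R u k + ztil k" and zk: "z k = ztil k" for k
  proof -
    let ?c = "(1 - ?r * \<theta> k) / (\<theta> k)\<^sup>2"
    \<comment> \<open>One formula for \<open>u\<close> covers all blocks: outside \<open>S k\<close>
      the increment of \<open>ztil\<close> is zero, inside it is \<open>t\<close>.\<close>
    have *: "block b i (z (Suc k)) = block b i (ztil (Suc k)) \<and>
      block b i (u (Suc k)) = block b i (u k - ?c *\<^sub>R (ztil (Suc k) - ztil k))" for i
    proof (cases "i \<in> S k")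
      case False
      then show ?thesis
        using alg1 alg2 zk by (simp add: algorithm1_def algorithm2_def block_diff block_scaleR)
    next
      case True
      obtain t where t: "is_arg_min
          (\<lambda>t. ereal (block b i (gradient f (y k)) \<bullet> t
                     + real CARD('n) * \<theta> k * v i / (2 * \<tau>) * (mat_norm (B i) t)\<^sup>2)
                   + \<psi> i (block b i (z k) + t)) (\<lambda>t. t \<in> block_space b i) t"
        and zt: "block b i (ztil (Suc k)) = block b i (ztil k) + t"
        and ut: "block b i (u (Suc k)) = block b i (u k) - ?c *\<^sub>R t"
        using alg2 True unfolding algorithm2_def yk zk by blast
      have w: "is_arg_min
          (\<lambda>w. ereal (block b i (gradient f (y k)) \<bullet> (w - block b i (y k))
                     + real CARD('n) * \<theta> k * v i / (2 * \<tau>)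
                         * (mat_norm (B i) (w - block b i (z k)))\<^sup>2) + \<psi> i w)
          (\<lambda>w. w \<in> block_space b i) (block b i (z (Suc k)))"
        using alg1 True unfolding algorithm1_def by blast
      have "0 < real CARD('n) * \<theta> k * v i / (2 * \<tau>)"
        using \<tau> v[of i] \<theta>_pos[of k] by simp
      from prox_step_unique[OF B this \<psi> block_in_block_space eff_domain_separable_sumD[OF x0]
          block_in_block_space w t]
      have "block b i (z (Suc k)) = block b i (z k) + t" .
      then show ?thesis
        using zt ut zk by (simp add: block_diff block_scaleR)
    qed
    have zS: "z (Suc k) = ztil (Suc k)"
      by (rule vec_eq_blockI[of b]) (use * in blast)
    have "u (Suc k) = u k - ?c *\<^sub>R (ztil (Suc k) - ztil k)"
      by (rule vec_eq_blockI[of b]) (use * in blast)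
    then have "(\<theta> k)\<^sup>2 *\<^sub>R u (Suc k)
        = (\<theta> k)\<^sup>2 *\<^sub>R u k - (1 - ?r * \<theta> k) *\<^sub>R (ztil (Suc k) - ztil k)"
      using \<theta>_pos[of k] by (simp add: scaleR_diff_right)
    \<comment> \<open>The unit part of the coefficient \<open>1 - ?r * \<theta> k\<close> cancels
      the increment from \<open>ztil k\<close> to \<open>ztil (Suc k)\<close>, leaving the
      extrapolation term of \<open>x (Suc k)\<close>.\<close>
    then have "x (Suc k) = (\<theta> k)\<^sup>2 *\<^sub>R u (Suc k) + ztil (Suc k)"
      unfolding x_Suc yk zS zk by (simp add: algebra_simps)
    with zS show ?thesis by blast
  qed
  \<comment> \<open>The identities for \<open>y\<close> and \<open>z\<close> at \<open>k\<close>
    give those for \<open>x\<close> and \<open>z\<close> at \<open>Suc k\<close>, which in turn give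
    the one for \<open>y\<close>.\<close>
  show ?thesis
  proof (induction k)
    case 0
    have "x 0 = ztil 0" "z 0 = ztil 0"
      using alg1 alg2 by (auto simp: algorithm1_def algorithm2_def)
    then show ?case using y_step[of 0] by simp
  next
    case (Suc k)
    then show ?case using step[of k] y_step[of "Suc k"] by simp
  qed
qed

theorem proposition1:
  fixes b :: "'d::finite \<Rightarrow> 'n::finite"
    and B :: "'n \<Rightarrow> real ^ 'd ^ 'd"
    and v :: "'n \<Rightarrow> real"
    and f :: "real ^ 'd \<Rightarrow> real"
    and \<psi> :: "'n \<Rightarrow> real ^ 'd \<Rightarrow> ereal"
    and Shat :: "'n set pmf"
    and M :: "'w measure"
    and S :: "nat \<Rightarrow> 'w \<Rightarrow> 'n set"
    and \<tau> :: real and \<theta> :: "nat \<Rightarrow> real"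
    and x0 :: "real ^ 'd"
    and x y z u ztil :: "nat \<Rightarrow> 'w \<Rightarrow> real ^ 'd"
  assumes "\<And>i. sym_pos_def_on_block b i (B i)"
    and "\<And>i. v i > 0"
    and "convex_on UNIV f"
    and "\<And>p. f differentiable (at p)"
    and "\<And>i. convex_extended_on (block_space b i) (\<psi> i)"
    and "uniform_sampling Shat"
    and "\<tau> = mean_sampling_size Shat"
    and "\<tau> > 0"
    and "\<theta> = theta_seq (\<tau> / real CARD('n))"
    and "prob_space M"
    and "\<And>k. S k \<in> measurable M (count_space UNIV)"
    and "\<And>k. distr M (count_space UNIV) (S k) = measure_pmf Shat"
    and "x0 \<in> eff_domain (separable_sum b \<psi>)"
    and "\<And>\<omega>. \<omega> \<in> space M \<Longrightarrow>
           algorithm1 b B v f \<psi> \<tau> \<theta> x0 (\<lambda>k. S k \<omega>) (\<lambda>k. x k \<omega>) (\<lambda>k. y k \<omega>) (\<lambda>k. z k \<omega>)"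
    and "\<And>\<omega>. \<omega> \<in> space M \<Longrightarrow>
           algorithm2 b B v f \<psi> \<tau> \<theta> x0 (\<lambda>k. S k \<omega>) (\<lambda>k. u k \<omega>) (\<lambda>k. ztil k \<omega>)"
  shows "\<forall>\<omega>\<in>space M. \<forall>k.
           x k \<omega> = (if k = 0 then ztil 0 \<omega> else (\<theta> (k - 1))\<^sup>2 *\<^sub>R u k \<omega> + ztil k \<omega>) \<and>
           y k \<omega> = (\<theta> k)\<^sup>2 *\<^sub>R u k \<omega> + ztil k \<omega> \<and>
           z k \<omega> = ztil k \<omega>"
proof (intro ballI allI)
  fix \<omega> k
  assume \<omega>: "\<omega> \<in> space M"
  have a: "0 < \<tau> / real CARD('n)"
    using assms(8) by simp
  show "x k \<omega> = (if k = 0 then ztil 0 \<omega> else (\<theta> (k - 1))\<^sup>2 *\<^sub>R u k \<omega> + ztil k \<omega>) \<and>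
        y k \<omega> = (\<theta> k)\<^sup>2 *\<^sub>R u k \<omega> + ztil k \<omega> \<and>
        z k \<omega> = ztil k \<omega>"
    \<comment> \<open>For a fixed outcome both algorithms run along the same sequence of sets, so
      the deterministic result applies.\<close>
    by (rule algorithms_equivalent[OF assms(1,2,5,8) _ _ assms(13) assms(14,15)[OF \<omega>]])
      (simp_all only: assms(9) theta_seq_pos[OF a] theta_seq_Suc_square)
qed

end
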